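(* Let $(R,\oplus,\odot)$ be a commutative ring with $1\neq 0$ such that there is a non-trivial zero-divisor $n\in R$. Assume that $z\notin R$, and set $S=R\cup\{z\}$. Define addition $+$ and multiplication $\cdot$ on $S$ as follows: (1) if $s,t\in R$, then $s+t=s\oplus t$, and if $s\in S$, then $s+z=z+s=s$; (2) if $s,t\in R$, then $s\cdot t=s\odot t$, and if $s\in S$, then $s\cdot z=z\cdot s=z$. Then the total quotient semiring $Q(S)$ of the semiring $(S,+,\cdot,z,1)$ is not a classical semiring.
   Context: A semiring is an algebraic structure $(S,+,\cdot,0,1)$ such that $(S,+,0)$ and $(S,\cdot,1)$ are commutative monoids, multiplication distributes over addition, and $s\cdot 0=0$ for all $s\in S$. In the statement, the zero of the semiring $S$ is $z$ and its one is the identity $1$ of $R$. A non-trivial zero-divisor of $R$ is a nonzero $n\in R$ such that $n\odot b=0$ for some nonzero $b\in R$. An element $s$ of a semiring $S$ is multiplicatively cancellative if $sx_1=sx_2$ implies $x_1=x_2$ for all $x_1,x_2\in S$; $MC(S)$ denotes the set of these elements. The total quotient semiring $Q(S)$ is the localization of $S$ at $MC(S)$: its elements are fractions $a/b$ with $a\in S$, $b\in MC(S)$, where $a/b=c/d$ if and only if $ad=bc$, with the usual operations $a/b+c/d=(ad+bc)/(bd)$ and $(a/b)(c/d)=(ac)/(bd)$. An element of a semiring is a unit if it has a multiplicative inverse; it is a zero-divisor if its product with some nonzero element is the zero of the semiring. A semiring is classical if each of its elements is either a unit or a zero-divisor. *)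

theory Defs
  imports "HOL-Algebra.Ring"
begin

text \<open>The locale \<open>semiring\<close> of HOL-Algebra contains annihilation by zero but not
  commutativity of multiplication; as here, it allows \<open>\<zero> = \<one>\<close>.\<close>

locale csemiring = semiring S + comm_monoid S for S (structure)

definition zero_divisor :: "('a, 'm) ring_scheme \<Rightarrow> 'a \<Rightarrow> bool"
  where "zero_divisor S s \<longleftrightarrow>
    s \<in> carrier S \<and> (\<exists>b \<in> carrier S. b \<noteq> \<zero>\<^bsub>S\<^esub> \<and> s \<otimes>\<^bsub>S\<^esub> b = \<zero>\<^bsub>S\<^esub>)"

definition nontrivial_zero_divisor :: "('a, 'm) ring_scheme \<Rightarrow> 'a \<Rightarrow> bool"
  where "nontrivial_zero_divisor S s \<longleftrightarrow> s \<noteq> \<zero>\<^bsub>S\<^esub> \<and> zero_divisor S s"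

definition classical_semiring :: "('a, 'm) ring_scheme \<Rightarrow> bool"
  where "classical_semiring S \<longleftrightarrow> (\<forall>s \<in> carrier S. s \<in> Units S \<or> zero_divisor S s)"

text \<open>The multiplicatively cancellative elements.\<close>

definition MC :: "('a, 'm) ring_scheme \<Rightarrow> 'a set"
  where "MC S = {s \<in> carrier S. \<forall>x\<^sub>1 \<in> carrier S. \<forall>x\<^sub>2 \<in> carrier S.
    s \<otimes>\<^bsub>S\<^esub> x\<^sub>1 = s \<otimes>\<^bsub>S\<^esub> x\<^sub>2 \<longrightarrow> x\<^sub>1 = x\<^sub>2}"

definition frac_rel :: "('a, 'm) ring_scheme \<Rightarrow> (('a \<times> 'a) \<times> ('a \<times> 'a)) set"
  where "frac_rel S = {((a, b), (c, d)).
    (a, b) \<in> carrier S \<times> MC S \<and> (c, d) \<in> carrier S \<times> MC S \<and> a \<otimes>\<^bsub>S\<^esub> d = b \<otimes>\<^bsub>S\<^esub> c}"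

definition fraction :: "('a, 'm) ring_scheme \<Rightarrow> 'a \<Rightarrow> 'a \<Rightarrow> ('a \<times> 'a) set"
  where "fraction S a b = frac_rel S `` {(a, b)}"

text \<open>In the operations below the unions range over representatives. By the lemmas
  \<open>total_quotient_add\<close> and \<open>total_quotient_mult\<close> they do not depend on the choice of
  representatives, so each union is a single equivalence class.\<close>

definition total_quotient :: "('a, 'm) ring_scheme \<Rightarrow> ('a \<times> 'a) set ring"
  where "total_quotient S =
    \<lparr> carrier = (carrier S \<times> MC S) // frac_rel S,
      mult = (\<lambda>X Y. \<Union>(a, b) \<in> X. \<Union>(c, d) \<in> Y. fraction S (a \<otimes>\<^bsub>S\<^esub> c) (b \<otimes>\<^bsub>S\<^esub> d)),
      one = fraction S \<one>\<^bsub>S\<^esub> \<one>\<^bsub>S\<^esub>,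
      zero = fraction S \<zero>\<^bsub>S\<^esub> \<one>\<^bsub>S\<^esub>,
      add = (\<lambda>X Y. \<Union>(a, b) \<in> X. \<Union>(c, d) \<in> Y.
        fraction S (a \<otimes>\<^bsub>S\<^esub> d \<oplus>\<^bsub>S\<^esub> b \<otimes>\<^bsub>S\<^esub> c) (b \<otimes>\<^bsub>S\<^esub> d)) \<rparr>"

definition adjoin_zero :: "('a, 'm) ring_scheme \<Rightarrow> 'a \<Rightarrow> 'a ring"
  where "adjoin_zero R z =
    \<lparr> carrier = carrier R \<union> {z},
      mult = (\<lambda>s t. if s = z \<or> t = z then z else s \<otimes>\<^bsub>R\<^esub> t),
      one = \<one>\<^bsub>R\<^esub>,
      zero = z,
      add = (\<lambda>s t. if t = z then s else if s = z then t else s \<oplus>\<^bsub>R\<^esub> t) \<rparr>"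

lemma adjoin_zero_csemiring:
  assumes "cring R" and "z \<notin> carrier R"
  shows "csemiring (adjoin_zero R z)"
proof -
  interpret R: cring R by fact
  have ne: "x \<in> carrier R \<Longrightarrow> x \<noteq> z" "x \<in> carrier R \<Longrightarrow> z \<noteq> x" for x
    using assms(2) by auto
  note ne = ne ne[OF R.add.m_closed] ne[OF R.m_closed]
  have "abelian_monoid (adjoin_zero R z)"
    by (rule abelian_monoidI) (auto simp: adjoin_zero_def ne R.a_ac)
  moreover have "comm_monoid (adjoin_zero R z)"
    by (rule comm_monoidI) (auto simp: adjoin_zero_def ne R.m_ac)
  moreover have "semiring_axioms (adjoin_zero R z)"
    by unfold_locales (auto simp: adjoin_zero_def ne R.l_distr R.r_distr)
  ultimately show ?thesis
    by (simp add: csemiring_def semiring_def comm_monoid_def)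
qed

context csemiring
begin

lemma MC_closed: "b \<in> MC S \<Longrightarrow> b \<in> carrier S"
  by (simp add: MC_def)

lemma MC_cancel: "\<lbrakk>b \<in> MC S; x \<in> carrier S; y \<in> carrier S; b \<otimes> x = b \<otimes> y\<rbrakk> \<Longrightarrow> x = y"
  by (simp add: MC_def)

lemma MC_one: "\<one> \<in> MC S"
  by (simp add: MC_def)

lemma MC_mult:
  assumes "b \<in> MC S" "d \<in> MC S"
  shows "b \<otimes> d \<in> MC S"
proof -
  have "x = y" if xy: "x \<in> carrier S" "y \<in> carrier S" "(b \<otimes> d) \<otimes> x = (b \<otimes> d) \<otimes> y" for x y
  proof -
    have "b \<otimes> (d \<otimes> x) = b \<otimes> (d \<otimes> y)" using xy assms[THEN MC_closed] by (simp add: m_assoc)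
    then have "d \<otimes> x = d \<otimes> y"
      by (rule MC_cancel[OF assms(1), rotated -1]) (use xy assms[THEN MC_closed] in auto)
    then show "x = y"
      by (rule MC_cancel[OF assms(2) xy(1,2)])
  qed
  then show ?thesis using assms[THEN MC_closed] by (auto simp: MC_def)
qed

lemma equiv_frac_rel: "equiv (carrier S \<times> MC S) (frac_rel S)"
proof (rule equivI)
  show "frac_rel S \<subseteq> (carrier S \<times> MC S) \<times> (carrier S \<times> MC S)"
    by (auto simp: frac_rel_def)
  show "refl_on (carrier S \<times> MC S) (frac_rel S)"
    by (auto simp: refl_on_def frac_rel_def MC_closed m_comm)
  show "sym (frac_rel S)"
    by (auto simp: sym_def frac_rel_def MC_closed m_comm)
  show "trans (frac_rel S)"
  proof (rule transI, clarsimp simp: frac_rel_def)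
    fix a b c d e f
    assume *: "a \<in> carrier S" "b \<in> MC S" "c \<in> carrier S" "d \<in> MC S"
      "e \<in> carrier S" "f \<in> MC S" and ad: "a \<otimes> d = b \<otimes> c" and cf: "c \<otimes> f = d \<otimes> e"
    note cl = * MC_closed[OF *(2)] MC_closed[OF *(4)] MC_closed[OF *(6)]
    have "d \<otimes> (a \<otimes> f) = (a \<otimes> d) \<otimes> f" using cl by (simp add: m_ac)
    also have "\<dots> = b \<otimes> (c \<otimes> f)" using cl ad by (simp add: m_assoc)
    also have "\<dots> = d \<otimes> (b \<otimes> e)" using cl cf by (simp add: m_ac)
    finally show "a \<otimes> f = b \<otimes> e" using cl by (auto intro: MC_cancel[OF *(4)])
  qed
qed

lemma fraction_eq_iff:
  assumes "a \<in> carrier S" "b \<in> MC S" "c \<in> carrier S" "d \<in> MC S"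
  shows "fraction S a b = fraction S c d \<longleftrightarrow> a \<otimes> d = b \<otimes> c"
  using eq_equiv_class_iff[OF equiv_frac_rel, of "(a, b)" "(c, d)"] assms
  by (auto simp: fraction_def frac_rel_def)

lemma total_quotient_carrier:
  "carrier (total_quotient S) = {fraction S a b | a b. a \<in> carrier S \<and> b \<in> MC S}"
  by (auto simp: total_quotient_def quotient_def fraction_def)

lemma total_quotient_mult:
  assumes "a \<in> carrier S" "b \<in> MC S" "c \<in> carrier S" "d \<in> MC S"
  shows "fraction S a b \<otimes>\<^bsub>total_quotient S\<^esub> fraction S c d = fraction S (a \<otimes> c) (b \<otimes> d)"
proof -
  have "(\<lambda>(a, b) (c, d). fraction S (a \<otimes> c) (b \<otimes> d)) respects2 (frac_rel S)"
  proof (rule congruent2I', clarsimp simp: frac_rel_def)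
    fix a b a' b' c d c' d'
    assume *: "a \<in> carrier S" "b \<in> MC S" "a' \<in> carrier S" "b' \<in> MC S"
      "c \<in> carrier S" "d \<in> MC S" "c' \<in> carrier S" "d' \<in> MC S"
      and e: "a \<otimes> b' = b \<otimes> a'" "c \<otimes> d' = d \<otimes> c'"
    note cl = * *(2,4,6,8)[THEN MC_closed]
    have "(a \<otimes> c) \<otimes> (b' \<otimes> d') = (a \<otimes> b') \<otimes> (c \<otimes> d')" using cl by (simp add: m_ac)
    also have "\<dots> = (b \<otimes> d) \<otimes> (a' \<otimes> c')" unfolding e using cl by (simp add: m_ac)
    finally show "fraction S (a \<otimes> c) (b \<otimes> d) = fraction S (a' \<otimes> c') (b' \<otimes> d')"
      using cl by (simp add: fraction_eq_iff MC_mult)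
  qed
  from UN_equiv_class2[OF equiv_frac_rel equiv_frac_rel this, of "(a, b)" "(c, d)"] assms
  show ?thesis by (simp add: total_quotient_def fraction_def case_prod_beta)
qed

lemma total_quotient_add:
  assumes "a \<in> carrier S" "b \<in> MC S" "c \<in> carrier S" "d \<in> MC S"
  shows "fraction S a b \<oplus>\<^bsub>total_quotient S\<^esub> fraction S c d
    = fraction S (a \<otimes> d \<oplus> b \<otimes> c) (b \<otimes> d)"
proof -
  have "(\<lambda>(a, b) (c, d). fraction S (a \<otimes> d \<oplus> b \<otimes> c) (b \<otimes> d)) respects2 (frac_rel S)"
  proof (rule congruent2I', clarsimp simp: frac_rel_def)
    fix a b a' b' c d c' d'
    assume *: "a \<in> carrier S" "b \<in> MC S" "a' \<in> carrier S" "b' \<in> MC S"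
      "c \<in> carrier S" "d \<in> MC S" "c' \<in> carrier S" "d' \<in> MC S"
      and e: "a \<otimes> b' = b \<otimes> a'" "c \<otimes> d' = d \<otimes> c'"
    note cl = * *(2,4,6,8)[THEN MC_closed]
    have 1: "(a \<otimes> d) \<otimes> (b' \<otimes> d') = (b \<otimes> d) \<otimes> (a' \<otimes> d')"
    proof -
      have "(a \<otimes> d) \<otimes> (b' \<otimes> d') = (a \<otimes> b') \<otimes> (d \<otimes> d')" using cl by (simp add: m_ac)
      also have "\<dots> = (b \<otimes> d) \<otimes> (a' \<otimes> d')" unfolding e(1) using cl by (simp add: m_ac)
      finally show ?thesis .
    qed
    have 2: "(b \<otimes> c) \<otimes> (b' \<otimes> d') = (b \<otimes> d) \<otimes> (b' \<otimes> c')"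
    proof -
      have "(b \<otimes> c) \<otimes> (b' \<otimes> d') = (b \<otimes> b') \<otimes> (c \<otimes> d')" using cl by (simp add: m_ac)
      also have "\<dots> = (b \<otimes> d) \<otimes> (b' \<otimes> c')" unfolding e(2) using cl by (simp add: m_ac)
      finally show ?thesis .
    qed
    have "(a \<otimes> d \<oplus> b \<otimes> c) \<otimes> (b' \<otimes> d')
        = (a \<otimes> d) \<otimes> (b' \<otimes> d') \<oplus> (b \<otimes> c) \<otimes> (b' \<otimes> d')"
      using cl by (simp add: l_distr)
    also have "\<dots> = (b \<otimes> d) \<otimes> (a' \<otimes> d' \<oplus> b' \<otimes> c')"
      unfolding 1 2 using cl by (simp add: r_distr)
    finally show "fraction S (a \<otimes> d \<oplus> b \<otimes> c) (b \<otimes> d)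
        = fraction S (a' \<otimes> d' \<oplus> b' \<otimes> c') (b' \<otimes> d')"
      using cl by (simp add: fraction_eq_iff MC_mult)
  qed
  from UN_equiv_class2[OF equiv_frac_rel equiv_frac_rel this, of "(a, b)" "(c, d)"] assms
  show ?thesis by (simp add: total_quotient_def fraction_def case_prod_beta)
qed

lemma total_quotient_csemiring: "csemiring (total_quotient S)"
proof -
  let ?Q = "total_quotient S"
  have one: "\<one>\<^bsub>?Q\<^esub> = fraction S \<one> \<one>" and zero: "\<zero>\<^bsub>?Q\<^esub> = fraction S \<zero> \<one>"
    by (simp_all add: total_quotient_def)
  have cases: thesis
    if "X \<in> carrier ?Q"
      "\<And>a b. \<lbrakk>a \<in> carrier S; b \<in> MC S; b \<in> carrier S; X = fraction S a b\<rbrakk> \<Longrightarrow> thesis"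
    for X thesis using that MC_closed by (auto simp: total_quotient_carrier)
  have closed: "fraction S a b \<in> carrier ?Q" if "a \<in> carrier S" "b \<in> MC S" for a b
    using that by (auto simp: total_quotient_carrier)
  note ops = total_quotient_add total_quotient_mult MC_mult MC_one one zero
  have add_assoc: "(X \<oplus>\<^bsub>?Q\<^esub> Y) \<oplus>\<^bsub>?Q\<^esub> Z = X \<oplus>\<^bsub>?Q\<^esub> (Y \<oplus>\<^bsub>?Q\<^esub> Z)"
    if "X \<in> carrier ?Q" "Y \<in> carrier ?Q" "Z \<in> carrier ?Q" for X Y Z
  proof (rule cases[OF that(1)], rule cases[OF that(2)], rule cases[OF that(3)])
    fix a b c d e f
    assume *: "a \<in> carrier S" "b \<in> MC S" "b \<in> carrier S"
      "c \<in> carrier S" "d \<in> MC S" "d \<in> carrier S" "e \<in> carrier S" "f \<in> MC S" "f \<in> carrier S"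
      and eq: "X = fraction S a b" "Y = fraction S c d" "Z = fraction S e f"
    have "(a \<otimes> d \<oplus> b \<otimes> c) \<otimes> f \<oplus> (b \<otimes> d) \<otimes> e = a \<otimes> (d \<otimes> f) \<oplus> b \<otimes> (c \<otimes> f \<oplus> d \<otimes> e)"
      using * by (simp add: l_distr r_distr m_assoc a_assoc)
    then show ?thesis using * by (simp add: eq ops m_assoc)
  qed
  have add_comm: "X \<oplus>\<^bsub>?Q\<^esub> Y = Y \<oplus>\<^bsub>?Q\<^esub> X"
    if "X \<in> carrier ?Q" "Y \<in> carrier ?Q" for X Y
  proof (rule cases[OF that(1)], rule cases[OF that(2)])
    fix a b c d
    assume *: "a \<in> carrier S" "b \<in> MC S" "b \<in> carrier S"
      "c \<in> carrier S" "d \<in> MC S" "d \<in> carrier S"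
      and eq: "X = fraction S a b" "Y = fraction S c d"
    have "a \<otimes> d \<oplus> b \<otimes> c = c \<otimes> b \<oplus> d \<otimes> a" and "b \<otimes> d = d \<otimes> b"
      using * by (simp_all add: m_comm a_comm)
    then show ?thesis using * by (simp add: eq ops)
  qed
  have mult_assoc: "(X \<otimes>\<^bsub>?Q\<^esub> Y) \<otimes>\<^bsub>?Q\<^esub> Z = X \<otimes>\<^bsub>?Q\<^esub> (Y \<otimes>\<^bsub>?Q\<^esub> Z)"
    if "X \<in> carrier ?Q" "Y \<in> carrier ?Q" "Z \<in> carrier ?Q" for X Y Z
    by (rule cases[OF that(1)], rule cases[OF that(2)], rule cases[OF that(3)])
      (simp add: ops m_assoc)
  have mult_comm: "X \<otimes>\<^bsub>?Q\<^esub> Y = Y \<otimes>\<^bsub>?Q\<^esub> X"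
    if "X \<in> carrier ?Q" "Y \<in> carrier ?Q" for X Y
    by (rule cases[OF that(1)], rule cases[OF that(2)]) (simp add: ops m_comm)
  have am: "abelian_monoid ?Q"
  proof (rule abelian_monoidI)
    show "X \<oplus>\<^bsub>?Q\<^esub> Y \<in> carrier ?Q" if "X \<in> carrier ?Q" "Y \<in> carrier ?Q" for X Y
      by (rule cases[OF that(1)], rule cases[OF that(2)]) (simp add: ops closed)
    show "\<zero>\<^bsub>?Q\<^esub> \<oplus>\<^bsub>?Q\<^esub> X = X" if "X \<in> carrier ?Q" for X
      by (rule cases[OF that]) (simp add: ops)
    show "\<zero>\<^bsub>?Q\<^esub> \<in> carrier ?Q" by (simp add: zero closed MC_one)
  qed (fact add_assoc add_comm)+
  have cm: "comm_monoid ?Q"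
  proof (rule comm_monoidI)
    show "X \<otimes>\<^bsub>?Q\<^esub> Y \<in> carrier ?Q" if "X \<in> carrier ?Q" "Y \<in> carrier ?Q" for X Y
      by (rule cases[OF that(1)], rule cases[OF that(2)]) (simp add: ops closed)
    show "\<one>\<^bsub>?Q\<^esub> \<otimes>\<^bsub>?Q\<^esub> X = X" if "X \<in> carrier ?Q" for X
      by (rule cases[OF that]) (simp add: ops)
    show "\<one>\<^bsub>?Q\<^esub> \<in> carrier ?Q" by (simp add: one closed MC_one)
  qed (fact mult_assoc mult_comm)+
  have distr: "(X \<oplus>\<^bsub>?Q\<^esub> Y) \<otimes>\<^bsub>?Q\<^esub> Z = X \<otimes>\<^bsub>?Q\<^esub> Z \<oplus>\<^bsub>?Q\<^esub> Y \<otimes>\<^bsub>?Q\<^esub> Z"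
    if "X \<in> carrier ?Q" "Y \<in> carrier ?Q" "Z \<in> carrier ?Q" for X Y Z
  proof (rule cases[OF that(1)], rule cases[OF that(2)], rule cases[OF that(3)])
    fix a b c d e f
    assume *: "a \<in> carrier S" "b \<in> MC S" "b \<in> carrier S"
      "c \<in> carrier S" "d \<in> MC S" "d \<in> carrier S" "e \<in> carrier S" "f \<in> MC S" "f \<in> carrier S"
      and eq: "X = fraction S a b" "Y = fraction S c d" "Z = fraction S e f"
    define u v where "u = a \<otimes> d" and "v = b \<otimes> c"
    have uv: "u \<in> carrier S" "v \<in> carrier S" using * by (simp_all add: u_def v_def)
    have "(a \<otimes> e) \<otimes> (d \<otimes> f) \<oplus> (b \<otimes> f) \<otimes> (c \<otimes> e) = u \<otimes> (e \<otimes> f) \<oplus> v \<otimes> (e \<otimes> f)"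
      using * by (simp add: u_def v_def m_ac)
    also have "\<dots> = (u \<oplus> v) \<otimes> (e \<otimes> f)" using uv * by (simp add: l_distr)
    finally have num: "(a \<otimes> e) \<otimes> (d \<otimes> f) \<oplus> (b \<otimes> f) \<otimes> (c \<otimes> e) = (u \<oplus> v) \<otimes> (e \<otimes> f)" .
    have "((u \<oplus> v) \<otimes> e) \<otimes> ((b \<otimes> f) \<otimes> (d \<otimes> f)) = ((b \<otimes> d) \<otimes> f) \<otimes> ((u \<oplus> v) \<otimes> (e \<otimes> f))"
      using a_closed[OF uv] * by (simp add: m_ac)
    then have "((a \<otimes> d \<oplus> b \<otimes> c) \<otimes> e) \<otimes> ((b \<otimes> f) \<otimes> (d \<otimes> f))
        = ((b \<otimes> d) \<otimes> f) \<otimes> ((a \<otimes> e) \<otimes> (d \<otimes> f) \<oplus> (b \<otimes> f) \<otimes> (c \<otimes> e))"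
      unfolding num by (simp add: u_def v_def)
    then show ?thesis using * by (simp add: eq ops fraction_eq_iff)
  qed
  have null: "\<zero>\<^bsub>?Q\<^esub> \<otimes>\<^bsub>?Q\<^esub> X = \<zero>\<^bsub>?Q\<^esub>" if "X \<in> carrier ?Q" for X
    by (rule cases[OF that]) (simp add: ops fraction_eq_iff)
  have "semiring_axioms ?Q"
  proof
    note closure = abelian_monoid.a_closed[OF am] abelian_monoid.zero_closed[OF am]
    show "Z \<otimes>\<^bsub>?Q\<^esub> (X \<oplus>\<^bsub>?Q\<^esub> Y) = Z \<otimes>\<^bsub>?Q\<^esub> X \<oplus>\<^bsub>?Q\<^esub> Z \<otimes>\<^bsub>?Q\<^esub> Y"
      if "X \<in> carrier ?Q" "Y \<in> carrier ?Q" "Z \<in> carrier ?Q" for X Y Z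
      using that distr[OF that] comm_monoid.m_comm[OF cm, of Z] closure by simp
    show "X \<otimes>\<^bsub>?Q\<^esub> \<zero>\<^bsub>?Q\<^esub> = \<zero>\<^bsub>?Q\<^esub>" if "X \<in> carrier ?Q" for X
      using null[OF that] comm_monoid.m_comm[OF cm that] closure by simp
  qed (simp_all add: distr null)
  with am cm show ?thesis
    by (simp add: csemiring_def semiring_def comm_monoid_def)
qed

end

end

theory Submission
  imports Defs
begin

text \<open>An element \<open>a\<close> of a semiring \<open>S\<close> can become a unit of the total quotient semiring only if it
  was already multiplicatively cancellative (\<open>MC_of_fraction_unit\<close>), and a zero-divisor only if it
  was already one (\<open>zero_divisor_of_fraction_zero_divisor\<close>). So if \<open>S\<close> has an element that is neither
  cancellative nor a zero-divisor, the total quotient is not classical.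

  Adjoining a new zero \<open>z\<close> to a ring \<open>R\<close> produces such elements. The old zero of \<open>R\<close> is no
  longer the zero of the semiring, and a product of elements of \<open>R\<close> stays in \<open>R\<close>, hence is never
  \<open>z\<close>: no element of \<open>R\<close> is a zero-divisor any more. But a zero-divisor \<open>n\<close> of \<open>R\<close> still maps two
  distinct elements, a nonzero \<open>b\<close> and \<open>\<zero>\<^bsub>R\<^esub>\<close>, to the same product, so it is not cancellative.\<close>

context csemiring
begin

lemma MC_factor:
  assumes "a \<in> carrier S" "c \<in> carrier S" "a \<otimes> c \<in> MC S"
  shows "a \<in> MC S"
proof -
  have "x = y" if xy: "x \<in> carrier S" "y \<in> carrier S" "a \<otimes> x = a \<otimes> y" for x y
  proof (rule MC_cancel[OF assms(3) xy(1,2)])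
    have "(a \<otimes> c) \<otimes> x = c \<otimes> (a \<otimes> x)" using assms(1,2) xy(1) by (simp add: m_ac)
    also have "\<dots> = (a \<otimes> c) \<otimes> y" unfolding xy(3) using assms(1,2) xy(2) by (simp add: m_ac)
    finally show "(a \<otimes> c) \<otimes> x = (a \<otimes> c) \<otimes> y" .
  qed
  then show ?thesis using assms(1) by (simp add: MC_def)
qed

text \<open>If \<open>c/d\<close> is inverse to \<open>a/1\<close>, then \<open>a \<otimes> c = d\<close>, and a factor of a cancellative element is
  cancellative.\<close>

lemma MC_of_fraction_unit:
  assumes a: "a \<in> carrier S" and unit: "fraction S a \<one> \<in> Units (total_quotient S)"
  shows "a \<in> MC S"
proof -
  obtain c d where c: "c \<in> carrier S" and d: "d \<in> MC S"
    and inv: "fraction S a \<one> \<otimes>\<^bsub>total_quotient S\<^esub> fraction S c d = \<one>\<^bsub>total_quotient S\<^esub>"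
    using unit by (auto simp: Units_def total_quotient_carrier)
  have "fraction S (a \<otimes> c) (\<one> \<otimes> d) = fraction S \<one> \<one>"
    using inv unfolding total_quotient_mult[OF a MC_one c d] by (simp add: total_quotient_def)
  then have "a \<otimes> c = d"
    using a c d by (simp add: fraction_eq_iff MC_one MC_closed)
  with d show ?thesis using MC_factor[OF a c] by simp
qed

text \<open>Both \<open>(a/1)(c/d) = 0\<close> and \<open>c/d = 0\<close> can be read off from numerators alone, as
  \<open>a \<otimes> c = \<zero>\<close> and \<open>c = \<zero>\<close>.\<close>

lemma zero_divisor_of_fraction_zero_divisor:
  assumes a: "a \<in> carrier S" and zd: "zero_divisor (total_quotient S) (fraction S a \<one>)"
  shows "zero_divisor S a"
proof -
  have zero: "\<zero>\<^bsub>total_quotient S\<^esub> = fraction S \<zero> \<one>"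
    by (simp add: total_quotient_def)
  have numerator: "fraction S x d = fraction S \<zero> \<one> \<longleftrightarrow> x = \<zero>"
    if "x \<in> carrier S" "d \<in> MC S" for x d
    using that by (simp add: fraction_eq_iff MC_one MC_closed)
  obtain c d where c: "c \<in> carrier S" and d: "d \<in> MC S"
    and nonzero: "fraction S c d \<noteq> fraction S \<zero> \<one>"
    and prod: "fraction S a \<one> \<otimes>\<^bsub>total_quotient S\<^esub> fraction S c d = fraction S \<zero> \<one>"
    using zd by (auto simp: zero_divisor_def total_quotient_carrier zero)
  have "c \<noteq> \<zero>" using nonzero numerator[OF c d] by simp
  moreover have "a \<otimes> c = \<zero>"
    using prod a c d unfolding total_quotient_mult[OF a MC_one c d]
    by (simp add: numerator MC_mult MC_one del: l_one)
  ultimately show ?thesis using a c by (auto simp: zero_divisor_def)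
qed

lemma MC_or_zero_divisor_of_classical_total_quotient:
  assumes "classical_semiring (total_quotient S)" and a: "a \<in> carrier S"
  shows "a \<in> MC S \<or> zero_divisor S a"
proof -
  have "fraction S a \<one> \<in> carrier (total_quotient S)"
    using a MC_one by (auto simp: total_quotient_carrier)
  with assms(1) show ?thesis
    using MC_of_fraction_unit[OF a] zero_divisor_of_fraction_zero_divisor[OF a]
    by (auto simp: classical_semiring_def)
qed

end

lemma adjoin_zero_not_zero_divisor:
  assumes "cring R" "z \<notin> carrier R" "a \<in> carrier R"
  shows "\<not> zero_divisor (adjoin_zero R z) a"
proof -
  interpret R: cring R by fact
  have "a \<otimes>\<^bsub>R\<^esub> b \<noteq> z" if "b \<in> carrier R" for b
    using R.m_closed[OF assms(3) that] assms(2) by auto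
  with assms show ?thesis by (auto simp: zero_divisor_def adjoin_zero_def)
qed

text \<open>If \<open>n \<otimes> b = \<zero>\<^bsub>R\<^esub>\<close> with \<open>b\<close> nonzero, then \<open>n\<close> fails to separate \<open>b\<close> from \<open>\<zero>\<^bsub>R\<^esub>\<close>, which is an
  ordinary element of the enlarged semiring.\<close>

lemma adjoin_zero_not_MC:
  assumes "cring R" "z \<notin> carrier R" "zero_divisor R n"
  shows "n \<notin> MC (adjoin_zero R z)"
proof
  interpret R: cring R by fact
  assume n: "n \<in> MC (adjoin_zero R z)"
  obtain b where b: "n \<in> carrier R" "b \<in> carrier R" "b \<noteq> \<zero>\<^bsub>R\<^esub>" "n \<otimes>\<^bsub>R\<^esub> b = \<zero>\<^bsub>R\<^esub>"
    using assms(3) by (auto simp: zero_divisor_def)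
  have "n \<noteq> z" "b \<noteq> z" "\<zero>\<^bsub>R\<^esub> \<noteq> z" using b assms(2) R.zero_closed by auto
  then have "n \<otimes>\<^bsub>adjoin_zero R z\<^esub> b = n \<otimes>\<^bsub>adjoin_zero R z\<^esub> \<zero>\<^bsub>R\<^esub>"
    using b by (simp add: adjoin_zero_def)
  moreover have "b \<in> carrier (adjoin_zero R z)" "\<zero>\<^bsub>R\<^esub> \<in> carrier (adjoin_zero R z)"
    using b by (simp_all add: adjoin_zero_def)
  ultimately have "b = \<zero>\<^bsub>R\<^esub>" using n by (simp add: MC_def)
  with b(3) show False by contradiction
qed

theorem theorem3p18:
  fixes R :: "('a, 'm) ring_scheme" and z :: 'a
  assumes "cring R" and "\<one>\<^bsub>R\<^esub> \<noteq> \<zero>\<^bsub>R\<^esub>"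
    and "\<exists>n. nontrivial_zero_divisor R n"
    and "z \<notin> carrier R"
  shows "\<not> classical_semiring (total_quotient (adjoin_zero R z))"
proof
  interpret S: csemiring "adjoin_zero R z"
    using assms(1,4) by (rule adjoin_zero_csemiring)
  assume classical: "classical_semiring (total_quotient (adjoin_zero R z))"
  obtain n where zd: "zero_divisor R n"
    using assms(3) by (auto simp: nontrivial_zero_divisor_def)
  then have n: "n \<in> carrier R" by (simp add: zero_divisor_def)
  then have "n \<in> carrier (adjoin_zero R z)" by (simp add: adjoin_zero_def)
  from S.MC_or_zero_divisor_of_classical_total_quotient[OF classical this]
  show False
    using adjoin_zero_not_MC[OF assms(1,4) zd] adjoin_zero_not_zero_divisor[OF assms(1,4) n]
    by simp
qed

end
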